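(* Let $I\subseteq(0,\infty)$ be an open interval, let $f:I\to\mathbb{R}$ be smooth, and let $M$ be the surface of revolution in the semi-isotropic space $\mathbb{SI}^3$ parameterized by $$r(u,v)=(r_1,r_2,r_3)(u,v)=(u\sinh v,\;u\cosh v,\;f(u)),\qquad (u,v)\in I\times\mathbb{R}.$$ Assume that $M$ has no parabolic points, i.e. $f'(u)f''(u)\neq0$ for all $u\in I$. If there are $\lambda_1,\lambda_2,\lambda_3\in\mathbb{R}$ such that $\bigtriangleup^{II}r_i=\lambda_ir_i$ for $i=1,2,3$, where $\bigtriangleup^{II}$ is the Laplace operator with respect to the second fundamental form, then $(\lambda_1,\lambda_2,\lambda_3)=(\lambda,\lambda,0)$ with $\lambda\neq0$, and the generating curve $u\mapsto(0,u,f(u))$ is of the form $$\left(0,\,u,\,-\frac{2}{\lambda}\ln u+c\right)$$ for some $c\in\mathbb{R}$.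
   Context: The semi-isotropic space $\mathbb{SI}^3$ is $\mathbb{R}^3$ with the scalar product $\langle a,b\rangle=a_1b_1-a_2b_2$ (for vectors that are not both of the form $(0,0,* )$; in that exceptional case $\langle a,b\rangle=a_3b_3$). For a parameterized surface $r(u,v)$ whose tangent planes contain no vector parallel to the $z$-axis, the first fundamental form has coefficients $E=\langle r_u,r_u\rangle$, $F=\langle r_u,r_v\rangle$, $G=\langle r_v,r_v\rangle$, with $W=EG-F^2$ assumed nonzero. The second fundamental form has coefficients $$L=\frac{\det(r_{uu},r_u,r_v)}{\sqrt{|W|}},\quad M=\frac{\det(r_{uv},r_u,r_v)}{\sqrt{|W|}},\quad N=\frac{\det(r_{vv},r_u,r_v)}{\sqrt{|W|}}.$$ Put $w=LN-M^2$. The surface has no parabolic points if $w\neq0$ everywhere; for the surface of revolution $r(u,v)=(u\sinh v,u\cosh v,f(u))$ one has $w=-uf'f''$. When there are no parabolic points, the Laplace operator with respect to the second fundamental form is defined on smooth functions $\psi(u,v)$ by $$\bigtriangleup^{II}\psi=-\frac{1}{\sqrt{|w|}}\left\{\frac{\partial}{\partial u}\left(\frac{N\psi_u-M\psi_v}{\sqrt{|w|}}\right)-\frac{\partial}{\partial v}\left(\frac{M\psi_u-L\psi_v}{\sqrt{|w|}}\right)\right\}.$$ *)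

theory Defs
  imports "HOL-Analysis.Analysis"
begin

text \<open>
  \<open>C\<^sup>\<infinity>\<close> on a set \<open>I\<close>, which is meant to be open: \<^const>\<open>deriv\<close> depends only on the germ of a
  function at a point, so the values of \<open>f\<close> outside \<open>I\<close> are irrelevant.
\<close>
definition smooth_on :: "real set \<Rightarrow> (real \<Rightarrow> real) \<Rightarrow> bool" where
  "smooth_on I f \<longleftrightarrow> (\<forall>n. \<forall>x\<in>I. (deriv ^^ n) f differentiable (at x))"

definition si_inner :: "real^3 \<Rightarrow> real^3 \<Rightarrow> real" where
  "si_inner a b =
     (if a$1 = 0 \<and> a$2 = 0 \<and> b$1 = 0 \<and> b$2 = 0 then a$3 * b$3
      else a$1 * b$1 - a$2 * b$2)"

text \<open>
  Partial derivatives, used for parameterized surfaces (values in \<open>real^3\<close>) as well as for scalar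
  functions (where \<^const>\<open>vector_derivative\<close> is the ordinary derivative).
\<close>
definition pdu :: "(real \<Rightarrow> real \<Rightarrow> 'a) \<Rightarrow> real \<Rightarrow> real \<Rightarrow> 'a::real_normed_vector" where
  "pdu g u v = vector_derivative (\<lambda>s. g s v) (at u)"

definition pdv :: "(real \<Rightarrow> real \<Rightarrow> 'a) \<Rightarrow> real \<Rightarrow> real \<Rightarrow> 'a::real_normed_vector" where
  "pdv g u v = vector_derivative (\<lambda>t. g u t) (at v)"

definition fff_E :: "(real \<Rightarrow> real \<Rightarrow> real^3) \<Rightarrow> real \<Rightarrow> real \<Rightarrow> real" where
  "fff_E r u v = si_inner (pdu r u v) (pdu r u v)"

definition fff_F :: "(real \<Rightarrow> real \<Rightarrow> real^3) \<Rightarrow> real \<Rightarrow> real \<Rightarrow> real" where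
  "fff_F r u v = si_inner (pdu r u v) (pdv r u v)"

definition fff_G :: "(real \<Rightarrow> real \<Rightarrow> real^3) \<Rightarrow> real \<Rightarrow> real \<Rightarrow> real" where
  "fff_G r u v = si_inner (pdv r u v) (pdv r u v)"

definition fff_W :: "(real \<Rightarrow> real \<Rightarrow> real^3) \<Rightarrow> real \<Rightarrow> real \<Rightarrow> real" where
  "fff_W r u v = fff_E r u v * fff_G r u v - (fff_F r u v)\<^sup>2"

definition sff_L :: "(real \<Rightarrow> real \<Rightarrow> real^3) \<Rightarrow> real \<Rightarrow> real \<Rightarrow> real" where
  "sff_L r u v =
     det (vector [pdu (pdu r) u v, pdu r u v, pdv r u v] :: real^3^3) / sqrt \<bar>fff_W r u v\<bar>"

definition sff_M :: "(real \<Rightarrow> real \<Rightarrow> real^3) \<Rightarrow> real \<Rightarrow> real \<Rightarrow> real" where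
  "sff_M r u v =
     det (vector [pdv (pdu r) u v, pdu r u v, pdv r u v] :: real^3^3) / sqrt \<bar>fff_W r u v\<bar>"

definition sff_N :: "(real \<Rightarrow> real \<Rightarrow> real^3) \<Rightarrow> real \<Rightarrow> real \<Rightarrow> real" where
  "sff_N r u v =
     det (vector [pdv (pdv r) u v, pdu r u v, pdv r u v] :: real^3^3) / sqrt \<bar>fff_W r u v\<bar>"

definition sff_w :: "(real \<Rightarrow> real \<Rightarrow> real^3) \<Rightarrow> real \<Rightarrow> real \<Rightarrow> real" where
  "sff_w r u v = sff_L r u v * sff_N r u v - (sff_M r u v)\<^sup>2"

definition no_parabolic_points :: "(real \<times> real) set \<Rightarrow> (real \<Rightarrow> real \<Rightarrow> real^3) \<Rightarrow> bool" where
  "no_parabolic_points D r \<longleftrightarrow> (\<forall>(u, v)\<in>D. sff_w r u v \<noteq> 0)"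

definition laplace_II :: "(real \<Rightarrow> real \<Rightarrow> real^3) \<Rightarrow> (real \<Rightarrow> real \<Rightarrow> real) \<Rightarrow> real \<Rightarrow> real \<Rightarrow> real" where
  "laplace_II r \<psi> u v =
     - (1 / sqrt \<bar>sff_w r u v\<bar>) *
       (pdu (\<lambda>s t. (sff_N r s t * pdu \<psi> s t - sff_M r s t * pdv \<psi> s t) / sqrt \<bar>sff_w r s t\<bar>) u v
        - pdv (\<lambda>s t. (sff_M r s t * pdu \<psi> s t - sff_L r s t * pdv \<psi> s t) / sqrt \<bar>sff_w r s t\<bar>) u v)"

definition rev_surface :: "(real \<Rightarrow> real) \<Rightarrow> real \<Rightarrow> real \<Rightarrow> real^3" where
  "rev_surface f u v = vector [u * sinh v, u * cosh v, f u]"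

definition generating_curve :: "(real \<Rightarrow> real) \<Rightarrow> real \<Rightarrow> real^3" where
  "generating_curve f u = vector [0, u, f u]"

text \<open>
  The lemmas below check the definitions against the known values \<open>W = - u\<^sup>2\<close> and \<open>w = - u f' f''\<close>;
  so \<open>W \<noteq> 0\<close> is automatic for surfaces of revolution with \<open>u > 0\<close>, and absence of parabolic points
  means \<open>f' f'' \<noteq> 0\<close>.
\<close>

lemma has_vector_derivative_vector_3:
  fixes a b c :: "real \<Rightarrow> real"
  assumes "(a has_real_derivative a') (at x)" "(b has_real_derivative b') (at x)"
    "(c has_real_derivative c') (at x)"
  shows "((\<lambda>s. vector [a s, b s, c s] :: real^3) has_vector_derivative vector [a', b', c']) (at x)"
proof -
  have eq: "vector [p, q, r] = p *\<^sub>R axis 1 1 + q *\<^sub>R axis 2 1 + r *\<^sub>R (axis 3 1 :: real^3)"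
    for p q r :: real
    by (simp add: vec_eq_iff forall_3 axis_def)
  show ?thesis
    unfolding eq using assms by (auto intro!: derivative_eq_intros simp: has_real_derivative_iff_has_vector_derivative)
qed

lemma pdv_rev_surface: "pdv (rev_surface f) u v = vector [u * cosh v, u * sinh v, 0]"
  unfolding pdv_def rev_surface_def
  by (intro vector_derivative_at has_vector_derivative_vector_3)
    (auto intro!: derivative_eq_intros)

lemma pdu_rev_surface:
  assumes "f differentiable (at u)"
  shows "pdu (rev_surface f) u v = vector [sinh v, cosh v, deriv f u]"
  unfolding pdu_def rev_surface_def
  by (intro vector_derivative_at has_vector_derivative_vector_3)
    (use assms in \<open>auto intro!: derivative_eq_intros simp: real_differentiable_def
      dest: DERIV_imp_deriv\<close>)

lemma fff_W_rev_surface: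
  assumes "f differentiable (at u)" and "u > 0"
  shows "fff_W (rev_surface f) u v = - u\<^sup>2"
proof -
  have "cosh v > 0" "(cosh v)\<^sup>2 = (sinh v)\<^sup>2 + 1" by (auto simp: cosh_square_eq)
  then show ?thesis using assms
    apply (simp add: fff_W_def fff_E_def fff_F_def fff_G_def si_inner_def pdu_rev_surface
        pdv_rev_surface)
    apply (simp add: power2_eq_square algebra_simps)
    done
qed

lemma sff_w_rev_surface:
  assumes "open I" and I: "I \<subseteq> {0<..}" and "smooth_on I f" and u: "u \<in> I"
  shows "sff_w (rev_surface f) u v = - u * deriv f u * deriv (deriv f) u"
proof -
  have d0: "f differentiable (at s)" and d1: "deriv f differentiable (at s)" if "s \<in> I" for s
    using assms(3) that unfolding smooth_on_def
    by (metis funpow_0, metis funpow_simps_right(1) funpow.simps comp_def id_apply)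
  have u0: "u > 0" using I u by auto
  have W: "fff_W (rev_surface f) u v = - u\<^sup>2"
    by (rule fff_W_rev_surface[OF d0[OF u] u0])
  have uu: "pdu (pdu (rev_surface f)) u v = vector [0, 0, deriv (deriv f) u]"
  proof -
    have "((\<lambda>s. vector [sinh v, cosh v, deriv f s] :: real^3) has_vector_derivative
        vector [0, 0, deriv (deriv f) u]) (at u)"
      by (intro has_vector_derivative_vector_3)
        (use d1[OF u] in \<open>auto simp: real_differentiable_def dest: DERIV_imp_deriv\<close>)
    then have "((\<lambda>s. pdu (rev_surface f) s v) has_vector_derivative
        vector [0, 0, deriv (deriv f) u]) (at u)"
      by (rule has_vector_derivative_transform_within_open[OF _ \<open>open I\<close> u])
        (simp add: pdu_rev_surface d0)
    then show ?thesis unfolding pdu_def[of "pdu _"] by (rule vector_derivative_at)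
  qed
  have uv: "pdv (pdu (rev_surface f)) u v = vector [cosh v, sinh v, 0]"
    unfolding pdv_def pdu_rev_surface[OF d0[OF u]]
    by (intro vector_derivative_at has_vector_derivative_vector_3)
      (auto intro!: derivative_eq_intros)
  have vv: "pdv (pdv (rev_surface f)) u v = vector [u * sinh v, u * cosh v, 0]"
    unfolding pdv_def[of "pdv _"] pdv_rev_surface
    by (intro vector_derivative_at has_vector_derivative_vector_3)
      (auto intro!: derivative_eq_intros)
  have cs: "cosh v * cosh v = sinh v * sinh v + 1"
    using cosh_square_eq[of v] by (simp add: power2_eq_square)
  have cs': "cosh v * (cosh v * x) = x + sinh v * (sinh v * x)" for x
    by (simp add: mult.assoc[symmetric] cs) (simp add: algebra_simps)
  have sq: "sqrt \<bar>fff_W (rev_surface f) u v\<bar> = u" using u0 W by simp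
  have "sff_L (rev_surface f) u v = - deriv (deriv f) u"
    unfolding sff_L_def sq uu pdu_rev_surface[OF d0[OF u]] pdv_rev_surface det_3
    using u0 by (simp add: field_simps cs')
  moreover have "sff_M (rev_surface f) u v = 0"
    unfolding sff_M_def sq uv pdu_rev_surface[OF d0[OF u]] pdv_rev_surface det_3
    by (simp add: algebra_simps)
  moreover have "sff_N (rev_surface f) u v = u * deriv f u"
    unfolding sff_N_def sq vv pdu_rev_surface[OF d0[OF u]] pdv_rev_surface det_3
    using u0 by (simp add: field_simps cs')
  ultimately show ?thesis by (simp add: sff_w_def)
qed

lemma no_parabolic_points_rev_surface_iff:
  assumes "open I" "I \<subseteq> {0<..}" "smooth_on I f"
  shows "no_parabolic_points (I \<times> UNIV) (rev_surface f) \<longleftrightarrow>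
    (\<forall>u\<in>I. deriv f u * deriv (deriv f) u \<noteq> 0)"
  using assms(2) by (auto simp: no_parabolic_points_def sff_w_rev_surface[OF assms])

end

theory Submission
  imports Defs
begin

text \<open>
  On a surface of revolution the second fundamental form is diagonal, with \<open>L = - f''\<close>,
  \<open>N = u f'\<close> and \<open>w = - u f' f''\<close>, so on the coordinate functions \<open>\<triangle>\<^sup>I\<^sup>I\<close> acts as an
  ordinary differential operator in \<open>u\<close> (lemma \<open>laplace_II_separable\<close>). With \<open>S = \<surd>|w|\<close> and
  \<open>P = N / S\<close>, the eigenvalue conditions become

    \<open>P' - u f'' / S = - \<lambda>\<^sub>1 u S = - \<lambda>\<^sub>2 u S\<close>  and  \<open>(P f')' = - \<lambda>\<^sub>3 f S\<close>,

  whence \<open>\<lambda>\<^sub>1 = \<lambda>\<^sub>2 = \<lambda>\<close>. Expand the second equation, replace \<open>P'\<close> by means of the first one, and use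
  \<open>S\<^sup>2 = \<epsilon> w\<close> with \<open>\<epsilon> = sgn w\<close>: the third derivative of \<open>f\<close> disappears and
  \<open>\<lambda> u f' = \<lambda>\<^sub>3 f - 2 \<epsilon>\<close> remains (lemma \<open>first_order_equation\<close>).

  This equation has power-type solutions, which the first equation excludes without any explicit
  integration. As \<open>\<epsilon>\<close> is locally constant, differentiation yields
  \<open>\<lambda> (f' + u f'') = \<lambda>\<^sub>3 f'\<close>. If \<open>\<lambda>\<close> were zero, then \<open>\<lambda>\<^sub>3\<close> and hence \<open>\<epsilon>\<close> would be zero as well; so
  \<open>\<lambda> \<noteq> 0\<close> and \<open>u f'' = (\<mu> - 1) f'\<close> with \<open>\<mu> = \<lambda>\<^sub>3 / \<lambda>\<close>. Then \<open>S = \<surd>|\<mu> - 1| |f'|\<close>, hence \<open>P\<close> is locally a constant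
  multiple of \<open>u\<close>, and the first equation says that \<open>u f'\<close> is constant. Differentiating
  once more gives \<open>\<mu> f' = 0\<close>, that is, \<open>\<lambda>\<^sub>3 = 0\<close> (lemma \<open>third_eigenvalue_zero\<close>). Now
  \<open>u f'' = - f'\<close> makes \<open>w = f'\<^sup>2\<close> positive, so \<open>\<epsilon> = 1\<close>, and \<open>\<lambda> u f' = - 2\<close> integrates to the logarithm.
\<close>

section \<open>Signs of nonvanishing differentiable functions\<close>

text \<open>
  The sign is locally constant where a continuous function does not vanish. This takes care of the
  absolute values under the square roots, without any case distinction on signs.
\<close>
lemma sgn_has_derivative_zero:
  fixes h :: "real \<Rightarrow> real"
  assumes "isCont h x" and "h x \<noteq> 0"
  shows "((\<lambda>s. sgn (h s)) has_real_derivative 0) (at x)"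
proof -
  have lim: "(h \<longlongrightarrow> h x) (nhds x)"
    using assms(1) by (simp add: isCont_def tendsto_nhds_iff)
  have "eventually (\<lambda>s. sgn (h s) = sgn (h x)) (nhds x)"
  proof (cases "h x > 0")
    case True
    then have "eventually (\<lambda>s. h s > 0) (nhds x)" by (rule order_tendstoD(1)[OF lim])
    then show ?thesis by eventually_elim (use True in simp)
  next
    case False
    then have neg: "h x < 0" using assms(2) by simp
    then have "eventually (\<lambda>s. h s < 0) (nhds x)" by (rule order_tendstoD(2)[OF lim])
    then show ?thesis by eventually_elim (use neg in simp)
  qed
  from DERIV_cong_ev[OF refl this refl] show ?thesis by (rule iffD2) (rule DERIV_const)
qed

section \<open>The second Laplace operator on a surface of revolution\<close>

locale nonparabolic_profile =
  fixes I :: "real set" and f :: "real \<Rightarrow> real"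
  assumes open_I: "open I" and pos: "u \<in> I \<Longrightarrow> u > 0"
    and smooth: "smooth_on I f"
    and nz1: "u \<in> I \<Longrightarrow> deriv f u \<noteq> 0" and nz2: "u \<in> I \<Longrightarrow> deriv (deriv f) u \<noteq> 0"
begin

abbreviation "f1 \<equiv> deriv f"
abbreviation "f2 \<equiv> deriv (deriv f)"

text \<open>
  These are \<open>\<surd>|w|\<close> and \<open>N / \<surd>|w|\<close> as functions of \<open>u\<close> alone; both are independent of \<open>v\<close>.
\<close>
definition S :: "real \<Rightarrow> real" where "S u = sqrt \<bar>u * f1 u * f2 u\<bar>"

definition P :: "real \<Rightarrow> real" where "P u = u * f1 u / S u"

lemma DERIV_f: "u \<in> I \<Longrightarrow> (f has_real_derivative f1 u) (at u)"
  using smooth[unfolded smooth_on_def, rule_format, of u 0]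
  by (simp add: DERIV_deriv_iff_real_differentiable)

lemma DERIV_f1: "u \<in> I \<Longrightarrow> (f1 has_real_derivative f2 u) (at u)"
  using smooth[unfolded smooth_on_def, rule_format, of u 1]
  by (simp add: DERIV_deriv_iff_real_differentiable)

lemma DERIV_f2: "u \<in> I \<Longrightarrow> (f2 has_real_derivative deriv f2 u) (at u)"
  using smooth[unfolded smooth_on_def, rule_format, of u 2]
  by (simp add: DERIV_deriv_iff_real_differentiable numeral_2_eq_2)

lemma DERIV_transform:
  assumes "(g has_real_derivative d) (at u)" "u \<in> I" "\<And>s. s \<in> I \<Longrightarrow> g s = h s"
  shows "(h has_real_derivative d) (at u)"
  using has_field_derivative_transform_within_open[OF assms(1) open_I assms(2,3)] .

lemma S_pos: "u \<in> I \<Longrightarrow> S u > 0"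
  using pos[of u] nz1[of u] nz2[of u] by (simp add: S_def)

lemma S_cancel: "u \<in> I \<Longrightarrow> x / S u = y \<Longrightarrow> x = y * S u"
  using S_pos[of u] by auto

lemma S_square: "u \<in> I \<Longrightarrow> S u * S u = sgn (u * f1 u * f2 u) * (u * f1 u * f2 u)"
  unfolding S_def real_sqrt_mult_self abs_abs by (subst abs_sgn) (rule mult.commute)

lemma pdu_f: "u \<in> I \<Longrightarrow> pdu (rev_surface f) u v = vector [sinh v, cosh v, f1 u]"
  using DERIV_f by (intro pdu_rev_surface) (auto simp: real_differentiable_def)

lemma sff_rev_surface:
  assumes u: "u \<in> I"
  shows "sff_L (rev_surface f) u v = - f2 u"
    and "sff_M (rev_surface f) u v = 0"
    and "sff_N (rev_surface f) u v = u * f1 u"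
proof -
  have u0: "u > 0" by (rule pos[OF u])
  have W: "fff_W (rev_surface f) u v = - u\<^sup>2"
    using DERIV_f[OF u] u0 by (intro fff_W_rev_surface) (auto simp: real_differentiable_def)
  have uu: "pdu (pdu (rev_surface f)) u v = vector [0, 0, f2 u]"
  proof -
    have "((\<lambda>s. vector [sinh v, cosh v, f1 s] :: real^3) has_vector_derivative
        vector [0, 0, f2 u]) (at u)"
      by (intro has_vector_derivative_vector_3 DERIV_const DERIV_f1 u)
    then have "((\<lambda>s. pdu (rev_surface f) s v) has_vector_derivative vector [0, 0, f2 u]) (at u)"
      by (rule has_vector_derivative_transform_within_open[OF _ open_I u]) (simp add: pdu_f)
    then show ?thesis unfolding pdu_def[of "pdu _"] by (rule vector_derivative_at)
  qed
  have uv: "pdv (pdu (rev_surface f)) u v = vector [cosh v, sinh v, 0]"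
    unfolding pdv_def pdu_f[OF u]
    by (intro vector_derivative_at has_vector_derivative_vector_3)
      (auto intro!: derivative_eq_intros)
  have vv: "pdv (pdv (rev_surface f)) u v = vector [u * sinh v, u * cosh v, 0]"
    unfolding pdv_def[of "pdv _"] pdv_rev_surface
    by (intro vector_derivative_at has_vector_derivative_vector_3)
      (auto intro!: derivative_eq_intros)
  have cs: "cosh v * cosh v = sinh v * sinh v + 1"
    using cosh_square_eq[of v] by (simp add: power2_eq_square)
  have cs': "cosh v * (cosh v * x) = x + sinh v * (sinh v * x)" for x
    by (simp add: mult.assoc[symmetric] cs) (simp add: algebra_simps)
  have sq: "sqrt \<bar>fff_W (rev_surface f) u v\<bar> = u" using u0 W by simp
  show "sff_L (rev_surface f) u v = - f2 u"
    unfolding sff_L_def sq uu pdu_f[OF u] pdv_rev_surface det_3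
    using u0 by (simp add: field_simps cs')
  show "sff_M (rev_surface f) u v = 0"
    unfolding sff_M_def sq uv pdu_f[OF u] pdv_rev_surface det_3
    by (simp add: algebra_simps)
  show "sff_N (rev_surface f) u v = u * f1 u"
    unfolding sff_N_def sq vv pdu_f[OF u] pdv_rev_surface det_3
    using u0 by (simp add: field_simps cs')
qed

lemma sqrt_sff_w: "u \<in> I \<Longrightarrow> sqrt \<bar>sff_w (rev_surface f) u v\<bar> = S u"
  by (simp add: sff_w_def sff_rev_surface S_def abs_mult)

text \<open>
  All three coordinate functions of the surface have separated variables, so this single formula
  yields all three eigenvalue equations.
\<close>
lemma laplace_II_separable:
  assumes u: "u \<in> I"
    and h: "\<And>s. s \<in> I \<Longrightarrow> (h has_real_derivative h' s) (at s)"
    and D: "((\<lambda>s. P s * h' s) has_real_derivative D) (at u)"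
    and g: "\<And>t. (g has_real_derivative g' t) (at t)"
    and g': "(g' has_real_derivative g'') (at v)"
  shows "laplace_II (rev_surface f) (\<lambda>s t. h s * g t) u v
           = - (D * g v - f2 u * h u * g'' / S u) / S u"
proof -
  let ?r = "rev_surface f" and ?\<psi> = "\<lambda>s t. h s * g t"
  have psi_u: "pdu ?\<psi> s t = h' s * g t" if "s \<in> I" for s t
    unfolding pdu_def
    by (intro vector_derivative_at)
      (auto simp flip: has_real_derivative_iff_has_vector_derivative
        intro!: derivative_eq_intros h that)
  have psi_v: "pdv ?\<psi> s t = h s * g' t" for s t
    unfolding pdv_def
    by (intro vector_derivative_at)
      (auto simp flip: has_real_derivative_iff_has_vector_derivative
        intro!: derivative_eq_intros g)
  have "((\<lambda>s. (P s * h' s) * g v) has_real_derivative D * g v) (at u)"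
    by (rule DERIV_cmult_right[OF D])
  then have "((\<lambda>s. (sff_N ?r s v * pdu ?\<psi> s v - sff_M ?r s v * pdv ?\<psi> s v)
      / sqrt \<bar>sff_w ?r s v\<bar>) has_real_derivative D * g v) (at u)"
    by (rule DERIV_transform[OF _ u]) (simp add: sff_rev_surface sqrt_sff_w psi_u P_def)
  then have 1: "pdu (\<lambda>s t. (sff_N ?r s t * pdu ?\<psi> s t - sff_M ?r s t * pdv ?\<psi> s t)
      / sqrt \<bar>sff_w ?r s t\<bar>) u v = D * g v"
    unfolding pdu_def[of "\<lambda>s t. _ s t / _ s t"]
    by (simp add: has_real_derivative_iff_has_vector_derivative vector_derivative_at)
  have "((\<lambda>t. f2 u * h u / S u * g' t) has_real_derivative f2 u * h u / S u * g'') (at v)"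
    by (rule DERIV_cmult[OF g'])
  then have 2: "pdv (\<lambda>s t. (sff_M ?r s t * pdu ?\<psi> s t - sff_L ?r s t * pdv ?\<psi> s t)
      / sqrt \<bar>sff_w ?r s t\<bar>) u v = f2 u * h u / S u * g''"
    unfolding pdv_def[of "\<lambda>s t. _ s t / _ s t"]
    by (simp add: has_real_derivative_iff_has_vector_derivative vector_derivative_at
        sff_rev_surface[OF u] sqrt_sff_w[OF u] psi_v mult.assoc)
  show ?thesis
    unfolding laplace_II_def 1 2 sqrt_sff_w[OF u] by (simp add: diff_divide_distrib)
qed

lemma P_differentiable: "u \<in> I \<Longrightarrow> \<exists>D. (P has_real_derivative D) (at u)"
proof -
  assume u: "u \<in> I"
  let ?w = "\<lambda>s. s * f1 s * f2 s"
  have w: "?w u \<noteq> 0" using pos[OF u] nz1[OF u] nz2[OF u] by simp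
  obtain d where dw: "(?w has_real_derivative d) (at u)"
    by (rule that, rule DERIV_mult[OF DERIV_mult[OF DERIV_ident DERIV_f1[OF u]] DERIV_f2[OF u]])
  note sg = sgn_has_derivative_zero[OF DERIV_isCont[OF dw] w]
  obtain d' where dw': "((\<lambda>s. \<bar>?w s\<bar>) has_real_derivative d') (at u)"
  proof (rule that)
    show "((\<lambda>s. \<bar>?w s\<bar>) has_real_derivative d * sgn (?w u) + 0 * ?w u) (at u)"
      unfolding abs_sgn by (rule DERIV_mult[OF dw sg])
  qed
  have "\<bar>?w u\<bar> > 0" using w by simp
  from DERIV_chain2[OF DERIV_real_sqrt[OF this] dw']
  have dS: "(S has_real_derivative inverse (sqrt \<bar>?w u\<bar>) / 2 * d') (at u)"
    unfolding S_def[abs_def] .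
  have "S u \<noteq> 0" using S_pos[OF u] by simp
  from DERIV_divide[OF DERIV_mult[OF DERIV_ident DERIV_f1[OF u]] dS this]
  show ?thesis unfolding P_def[abs_def] by (rule exI)
qed

section \<open>The eigenvalue equations\<close>

text \<open>
  The parameter \<open>v\<close> enters only through a common factor \<open>sinh v\<close> or \<open>cosh v\<close>, so one value of \<open>v\<close>
  suffices for each coordinate, provided that this factor is nonzero there: \<open>v = 1\<close> for \<open>sinh\<close>,
  \<open>v = 0\<close> for \<open>cosh\<close>.
\<close>
lemma eigen_1_2:
  assumes u: "u \<in> I" and D: "(P has_real_derivative D) (at u)"
  shows "laplace_II (rev_surface f) (\<lambda>u v. rev_surface f u v $ 1) u 1 = a * rev_surface f u 1 $ 1
           \<Longrightarrow> D - u * f2 u / S u = - a * u * S u"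
    and "laplace_II (rev_surface f) (\<lambda>u v. rev_surface f u v $ 2) u 0 = a * rev_surface f u 0 $ 2
           \<Longrightarrow> D - u * f2 u / S u = - a * u * S u"
proof -
  have D': "((\<lambda>s. P s * 1) has_real_derivative D) (at u)" using D by simp
  have s: "sinh (1::real) > 0" by simp
  have "laplace_II (rev_surface f) (\<lambda>s t. s * sinh t) u 1
      = - (D * sinh 1 - f2 u * u * sinh 1 / S u) / S u"
    by (rule laplace_II_separable[OF u _ D']) (auto intro!: derivative_eq_intros)
  then have 1: "laplace_II (rev_surface f) (\<lambda>u v. rev_surface f u v $ 1) u 1
      = - (D - u * f2 u / S u) * sinh 1 / S u"
    by (simp add: rev_surface_def algebra_simps)
  have "laplace_II (rev_surface f) (\<lambda>s t. s * cosh t) u 0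
      = - (D * cosh 0 - f2 u * u * cosh 0 / S u) / S u"
    by (rule laplace_II_separable[OF u _ D']) (auto intro!: derivative_eq_intros)
  then have 2: "laplace_II (rev_surface f) (\<lambda>u v. rev_surface f u v $ 2) u 0
      = - (D - u * f2 u / S u) / S u"
    by (simp add: rev_surface_def algebra_simps)
  let ?A = "D - u * f2 u / S u"
  show "?A = - a * u * S u"
    if "laplace_II (rev_surface f) (\<lambda>u v. rev_surface f u v $ 1) u 1 = a * rev_surface f u 1 $ 1"
  proof -
    have "- ?A * sinh 1 / S u = a * (u * sinh 1)"
      using that unfolding 1 by (simp add: rev_surface_def)
    then have "- ?A * sinh 1 = a * (u * sinh 1) * S u" by (rule S_cancel[OF u])
    then have "(- ?A) * sinh 1 = (a * u * S u) * sinh 1" by (simp only: mult_ac)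
    then show ?thesis using s by simp
  qed
  show "?A = - a * u * S u"
    if "laplace_II (rev_surface f) (\<lambda>u v. rev_surface f u v $ 2) u 0 = a * rev_surface f u 0 $ 2"
  proof -
    have "- ?A / S u = a * u"
      using that unfolding 2 by (simp add: rev_surface_def)
    then have "- ?A = a * u * S u" by (rule S_cancel[OF u])
    then show ?thesis by simp
  qed
qed

lemma eigen_3:
  assumes u: "u \<in> I" and D: "(P has_real_derivative D) (at u)"
    and e: "laplace_II (rev_surface f) (\<lambda>u v. rev_surface f u v $ 3) u 0
              = c * rev_surface f u 0 $ 3"
  shows "D * f1 u + P u * f2 u = - c * f u * S u"
proof -
  have "((\<lambda>s. P s * f1 s) has_real_derivative D * f1 u + P u * f2 u) (at u)"
    (is "(_ has_real_derivative ?A) _")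
    using DERIV_mult[OF D DERIV_f1[OF u]] by (simp add: mult.commute)
  from laplace_II_separable[OF u DERIV_f this, of "\<lambda>_. 1" "\<lambda>_. 0" 0 0]
  have "laplace_II (rev_surface f) (\<lambda>s t. f s * 1) u 0
      = - (?A * 1 - f2 u * f u * 0 / S u) / S u"
    by simp
  then have "- ?A / S u = c * f u" using e by (simp add: rev_surface_def)
  then have "- ?A = c * f u * S u" by (rule S_cancel[OF u])
  then show ?thesis by simp
qed

text \<open>
  In \<open>(P f')' = P' f' + P f''\<close> both \<open>P f''\<close> and the part \<open>u f' f'' / S\<close> of \<open>P' f'\<close> are equal to
  \<open>- w / S = - \<epsilon> S\<close>, so that a factor \<open>S\<close> cancels. Below, \<open>- \<epsilon>\<close> appears as \<open>sgn (u f' f'')\<close>.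
\<close>
lemma first_order_equation:
  assumes u: "u \<in> I"
    and e1: "D - u * f2 u / S u = - a * u * S u"
    and e3: "D * f1 u + P u * f2 u = - c * f u * S u"
  shows "a * u * f1 u = c * f u + 2 * sgn (u * f1 u * f2 u)"
proof -
  let ?e = "sgn (u * f1 u * f2 u)"
  have S0: "S u > 0" by (rule S_pos[OF u])
  have "?e * ?e = 1"
    using pos[OF u] nz1[OF u] nz2[OF u] by (simp add: sgn_if)
  then have "u * f1 u * f2 u = ?e * (S u * S u)"
    unfolding S_square[OF u] by (simp only: mult.assoc[symmetric] mult_1_left)
  then have q: "u * f1 u * f2 u / S u = ?e * S u"
    using S0 by (simp add: divide_eq_eq)
  have "D = u * f2 u / S u - a * u * S u" using e1 by simp
  then have "D * f1 u = (u * f2 u / S u - a * u * S u) * f1 u" by simp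
  also have "\<dots> = u * f1 u * f2 u / S u - a * u * S u * f1 u"
    by (simp add: left_diff_distrib right_diff_distrib mult.commute mult.left_commute)
  finally have "D * f1 u = u * f1 u * f2 u / S u - a * u * S u * f1 u" .
  moreover have "P u * f2 u = u * f1 u * f2 u / S u" by (simp add: P_def)
  ultimately have "2 * (?e * S u) - a * u * S u * f1 u = - c * f u * S u"
    using e3 q by linarith
  then have "S u * (a * u * f1 u) = S u * (c * f u + 2 * ?e)"
    by (simp add: algebra_simps)
  then show ?thesis using S0 by simp
qed

text \<open>The sign in the first-order equation is locally constant, so it drops out here.\<close>
lemma differentiated_equation:
  assumes e: "\<And>u. u \<in> I \<Longrightarrow> a * u * f1 u = c * f u + 2 * sgn (u * f1 u * f2 u)"
    and u: "u \<in> I"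
  shows "a * (f1 u + u * f2 u) = c * f1 u"
proof -
  have w: "u * f1 u * f2 u \<noteq> 0" using pos[OF u] nz1[OF u] nz2[OF u] by simp
  have "isCont (\<lambda>s. s * f1 s * f2 s) u"
    by (intro continuous_intros DERIV_isCont[OF DERIV_f1[OF u]] DERIV_isCont[OF DERIV_f2[OF u]])
  note sg = sgn_has_derivative_zero[OF this w]
  have "((\<lambda>s. c * f s + 2 * sgn (s * f1 s * f2 s)) has_real_derivative c * f1 u) (at u)"
    by (auto intro!: derivative_eq_intros DERIV_f u sg)
  then have "((\<lambda>s. a * s * f1 s) has_real_derivative c * f1 u) (at u)"
    by (rule DERIV_transform[OF _ u]) (simp add: e)
  moreover have "((\<lambda>s. a * s * f1 s) has_real_derivative a * (f1 u + u * f2 u)) (at u)"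
    by (auto intro!: derivative_eq_intros DERIV_f1 u simp: algebra_simps)
  ultimately show ?thesis by (rule DERIV_unique[symmetric])
qed

text \<open>
  Where \<open>u f'' = k f'\<close>, the function \<open>P = sgn f' \<sqdot> u / \<surd>|k|\<close> is locally linear. The equation for
  \<open>P'\<close> then determines \<open>u f'\<close> as \<open>(k - 1) / (a |k|)\<close>; being constant, it has derivative
  \<open>(k + 1) f' = 0\<close>.
\<close>
lemma third_eigenvalue_zero:
  assumes ne: "I \<noteq> {}" and a: "a \<noteq> 0"
    and e1: "\<And>u D. u \<in> I \<Longrightarrow> (P has_real_derivative D) (at u)
               \<Longrightarrow> D - u * f2 u / S u = - a * u * S u"
    and de: "\<And>u. u \<in> I \<Longrightarrow> a * (f1 u + u * f2 u) = c * f1 u"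
  shows "c = 0"
proof -
  \<comment> \<open>In the notation of the introduction, \<open>k = \<mu> - 1\<close>.\<close>
  define k where "k = c / a - 1"
  have k: "u * f2 u = k * f1 u" if "u \<in> I" for u
  proof -
    have "a * (f1 u + u * f2 u) = a * ((k + 1) * f1 u)"
      using de[OF that] a by (simp add: k_def)
    then have "f1 u + u * f2 u = (k + 1) * f1 u" using a mult_left_cancel by blast
    then show ?thesis by (simp add: distrib_right)
  qed
  obtain u0 where u0: "u0 \<in> I" using ne by blast
  have "u0 * f2 u0 \<noteq> 0" using pos[OF u0] nz2[OF u0] by simp
  then have k0: "k \<noteq> 0" unfolding k[OF u0] by simp
  define q where "q = sqrt \<bar>k\<bar>"
  have q0: "q > 0" and qq: "q * q = \<bar>k\<bar>" using k0 by (auto simp: q_def)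
  have S: "S u = q * \<bar>f1 u\<bar>" if "u \<in> I" for u
  proof -
    have "u * f1 u * f2 u = k * (f1 u * f1 u)" using k[OF that] by (simp add: algebra_simps)
    then have "S u = sqrt \<bar>k * (f1 u * f1 u)\<bar>" by (simp only: S_def)
    then show ?thesis by (simp add: q_def abs_mult real_sqrt_mult)
  qed
  have const: "u * f1 u = (k - 1) / (a * \<bar>k\<bar>)" if u: "u \<in> I" for u
  proof -
    have "((\<lambda>s. s * sgn (f1 s) / q) has_real_derivative sgn (f1 u) / q) (at u)"
      using sgn_has_derivative_zero[OF DERIV_isCont[OF DERIV_f1[OF u]] nz1[OF u]] q0
      by (auto intro!: derivative_eq_intros)
    then have "(P has_real_derivative sgn (f1 u) / q) (at u)"
    proof (rule DERIV_transform[OF _ u])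
      fix s assume s: "s \<in> I"
      show "s * sgn (f1 s) / q = P s"
        by (simp add: P_def S[OF s] real_sgn_eq mult.commute)
    qed
    from e1[OF u this] have "sgn (f1 u) / q - k * f1 u / (q * \<bar>f1 u\<bar>) = - a * u * (q * \<bar>f1 u\<bar>)"
      by (simp add: S[OF u] k[OF u])
    moreover have "k * f1 u / (q * \<bar>f1 u\<bar>) = k * sgn (f1 u) / q"
      by (simp add: real_sgn_eq mult.commute)
    ultimately have "(1 - k) * sgn (f1 u) / q = - a * u * (q * \<bar>f1 u\<bar>)"
      by (simp add: left_diff_distrib diff_divide_distrib)
    then have "(1 - k) * sgn (f1 u) = - a * u * (q * \<bar>f1 u\<bar>) * q"
      using q0 by (simp only: divide_eq_eq)
    then have "(1 - k) * (sgn (f1 u) * sgn (f1 u)) = - a * u * (q * q) * (\<bar>f1 u\<bar> * sgn (f1 u))"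
      by (simp only: mult.assoc[symmetric]) (simp only: mult_ac)
    moreover have "sgn (f1 u) * sgn (f1 u) = 1" using nz1[OF u] by (simp add: sgn_if)
    moreover have "\<bar>f1 u\<bar> * sgn (f1 u) = f1 u" by (simp add: abs_mult_sgn)
    ultimately have "1 - k = - a * u * \<bar>k\<bar> * f1 u" unfolding qq by simp
    then have "u * f1 u * (a * \<bar>k\<bar>) = k - 1" by (simp add: algebra_simps)
    then show ?thesis using a k0 by (simp add: nonzero_eq_divide_eq)
  qed
  have "((\<lambda>s. s * f1 s) has_real_derivative 0) (at u0)"
    by (rule DERIV_transform[OF DERIV_const u0]) (simp add: const)
  moreover have "((\<lambda>s. s * f1 s) has_real_derivative f1 u0 + u0 * f2 u0) (at u0)"
    by (auto intro!: derivative_eq_intros DERIV_f1 u0)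
  ultimately have "f1 u0 + u0 * f2 u0 = 0" by (metis DERIV_unique)
  then show "c = 0" using de[OF u0] nz1[OF u0] by simp
qed

lemma logarithmic_profile:
  assumes "is_interval I" and a: "a \<noteq> 0" and e: "\<And>u. u \<in> I \<Longrightarrow> a * u * f1 u = - 2"
  shows "\<exists>c. \<forall>u\<in>I. f u = - (2 / a) * ln u + c"
proof -
  have "((\<lambda>s. f s + 2 / a * ln s) has_real_derivative 0) (at u within I)" if u: "u \<in> I" for u
  proof -
    have "((\<lambda>s. f s + 2 / a * ln s) has_real_derivative f1 u + 2 / a * (1 / u)) (at u)"
      by (intro DERIV_add DERIV_f u DERIV_cmult DERIV_ln_divide pos)
    moreover have "f1 u + 2 / a * (1 / u) = 0"
      using e[OF u] a pos[OF u] by (simp add: field_simps)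
    ultimately have "((\<lambda>s. f s + 2 / a * ln s) has_real_derivative 0) (at u)" by simp
    then show ?thesis by (rule DERIV_subset) simp
  qed
  then have "\<exists>c. \<forall>u\<in>I. f u + 2 / a * ln u = c"
    by (intro has_field_derivative_zero_constant is_interval_convex assms(1))
  then obtain c where c: "f u + 2 / a * ln u = c" if "u \<in> I" for u by blast
  have "f u = - (2 / a) * ln u + c" if "u \<in> I" for u
    by (simp add: c[OF that, symmetric])
  then show ?thesis by blast
qed

end

section \<open>Classification\<close>

theorem theorem4p3:
  fixes I :: "real set" and f :: "real \<Rightarrow> real" and lam1 lam2 lam3 :: real
  assumes "open I" and "is_interval I" and "I \<noteq> {}" and "I \<subseteq> {0<..}"
    and "smooth_on I f"
    and "no_parabolic_points (I \<times> UNIV) (rev_surface f)"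
    and "\<forall>u\<in>I. \<forall>v. laplace_II (rev_surface f) (\<lambda>u v. rev_surface f u v $ 1) u v
                     = lam1 * rev_surface f u v $ 1"
    and "\<forall>u\<in>I. \<forall>v. laplace_II (rev_surface f) (\<lambda>u v. rev_surface f u v $ 2) u v
                     = lam2 * rev_surface f u v $ 2"
    and "\<forall>u\<in>I. \<forall>v. laplace_II (rev_surface f) (\<lambda>u v. rev_surface f u v $ 3) u v
                     = lam3 * rev_surface f u v $ 3"
  shows "\<exists>lam. lam \<noteq> 0 \<and> (lam1, lam2, lam3) = (lam, lam, 0) \<and>
           (\<exists>c. \<forall>u\<in>I. generating_curve f u = vector [0, u, - (2 / lam) * ln u + c])"
proof -
  have nz: "deriv f u * deriv (deriv f) u \<noteq> 0" if "u \<in> I" for u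
    using assms(6) that no_parabolic_points_rev_surface_iff[OF assms(1,4,5)] by blast
  interpret nonparabolic_profile I f
    using assms(1,4,5) nz by unfold_locales auto
  have e1: "D - u * f2 u / S u = - lam1 * u * S u"
    and e2: "D - u * f2 u / S u = - lam2 * u * S u"
    and e3: "D * f1 u + P u * f2 u = - lam3 * f u * S u"
    if "u \<in> I" "(P has_real_derivative D) (at u)" for u D
    using eigen_1_2[OF that] eigen_3[OF that] assms(7-9) that(1) by blast+
  obtain u0 where u0: "u0 \<in> I" using assms(3) by blast
  obtain D0 where D0: "(P has_real_derivative D0) (at u0)" using P_differentiable[OF u0] by blast
  have "lam1 * (u0 * S u0) = lam2 * (u0 * S u0)"
    using e1[OF u0 D0] e2[OF u0 D0] by (simp only: mult.assoc mult_minus_left)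
  then have l12: "lam1 = lam2" using pos[OF u0] S_pos[OF u0] by auto
  have fo: "lam1 * u * f1 u = lam3 * f u + 2 * sgn (u * f1 u * f2 u)" if u: "u \<in> I" for u
  proof -
    obtain D where D: "(P has_real_derivative D) (at u)" using P_differentiable[OF u] by blast
    show ?thesis by (rule first_order_equation[OF u e1[OF u D] e3[OF u D]])
  qed
  have de: "lam1 * (f1 u + u * f2 u) = lam3 * f1 u" if u: "u \<in> I" for u
    by (rule differentiated_equation[OF _ u]) (rule fo)
  have l1: "lam1 \<noteq> 0"
  proof
    assume "lam1 = 0"
    moreover from this have "lam3 = 0" using de[OF u0] nz1[OF u0] by simp
    ultimately have "sgn (u0 * f1 u0 * f2 u0) = 0" using fo[OF u0] by simp
    then show False using nz[OF u0] pos[OF u0] by (simp add: sgn_zero_iff)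
  qed
  have l3: "lam3 = 0" by (rule third_eigenvalue_zero[OF assms(3) l1]) (rule e1 de; assumption)+
  have slope: "lam1 * u * f1 u = - 2" if u: "u \<in> I" for u
  proof -
    have "u * f2 u = - f1 u" using de[OF u] l1 l3 by simp
    then have "(u * f2 u) * f1 u = - f1 u * f1 u" by simp
    then have "u * f1 u * f2 u = - (f1 u * f1 u)" by (simp add: mult_ac)
    moreover have "f1 u * f1 u > 0" using nz1[OF u] by (simp add: zero_less_mult_iff) linarith
    ultimately have "sgn (u * f1 u * f2 u) = - 1" by simp
    then show ?thesis using fo[OF u] l3 by simp
  qed
  have "\<exists>c. \<forall>u\<in>I. f u = - (2 / lam1) * ln u + c"
    by (rule logarithmic_profile[OF assms(2) l1]) (rule slope)
  then obtain c where "\<forall>u\<in>I. f u = - (2 / lam1) * ln u + c" ..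
  then show ?thesis
    using l1 l3 l12 by (intro exI[of _ lam1]) (auto simp: generating_curve_def)
qed

end
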